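(* Let $a\geq 3$ and let $d=2^{a-1}m$ where $m\geq 31$ is an integer. Let $r$ be the largest integer with $2^r-2^{a-1}\leq d$, and suppose $m\neq 2^{r-a+1}-1$. Then for all integers $n\geq 2m+2^{r-a+1}+1$, \[ \Delta_d^{(a,-,-)}(2^{a-1}n) := q_d^{(a)}(2^{a-1}n) - Q_d^{(a,-,-)}(2^{a-1}n) \geq 0 . \]
   Context: For positive integers $a,d,n$, $q_d^{(a)}(n)$ denotes the number of partitions of $n$ in which every part is at least $a$ and any two parts differ by at least $d$. For $1\le b\le d+2$, $Q_d^{(b,-,-)}(n)$ denotes the number of partitions of $n$ into parts congruent to $\pm b \pmod{d+3}$, where the parts $b$ and $d+3-b$ are not allowed. *)

theory Defs
  imports "HOL-Library.Multiset" "HOL-Number_Theory.Cong"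
begin

definition partitions :: "nat \<Rightarrow> nat multiset set" where
  "partitions n = {P. 0 \<notin># P \<and> sum_mset P = n}"

lemma finite_partitions: "finite (partitions n)"
proof (rule finite_subset)
  show "partitions n \<subseteq> mset ` {xs. set xs \<subseteq> {..n} \<and> length xs \<le> n}"
  proof
    fix P assume P: "P \<in> partitions n"
    obtain xs where xs: "P = mset xs" by (metis ex_mset)
    have pos: "0 \<notin> set xs" and sum: "sum_list xs = n"
      using P unfolding xs partitions_def by (simp_all add: sum_mset_sum_list)
    have "length xs \<le> sum_list xs" using pos by (induction xs) auto
    moreover have "x \<le> sum_list xs" if "x \<in> set xs" for x
      using that by (simp add: member_le_sum_list)
    ultimately have "xs \<in> {xs. set xs \<subseteq> {..n} \<and> length xs \<le> n}"
      using sum by blast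
    then show "P \<in> mset ` {xs. set xs \<subseteq> {..n} \<and> length xs \<le> n}"
      unfolding xs by (rule imageI)
  qed
  show "finite (mset ` {xs. set xs \<subseteq> {..n} \<and> length xs \<le> n})"
    by (intro finite_imageI finite_lists_length_le) simp
qed

text \<open>``Any two parts'' refers to two occurrences of parts, so a repeated part counts as a pair
  with difference 0. This is what \<open>{#x, y#} \<subseteq># P\<close> expresses.\<close>
definition q :: "nat \<Rightarrow> nat \<Rightarrow> nat \<Rightarrow> nat" where
  "q d a n = card {P \<in> partitions n.
     (\<forall>x \<in># P. a \<le> x) \<and>
     (\<forall>x y. {#x, y#} \<subseteq># P \<longrightarrow> int d \<le> \<bar>int x - int y\<bar>)}"

text \<open>The superscript \<open>(b,-,-)\<close>: both \<open>b\<close> and \<open>d + 3 - b\<close> are excluded as parts.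
  Intended for \<open>1 \<le> b \<le> d + 2\<close>.\<close>
definition Q_mm :: "nat \<Rightarrow> nat \<Rightarrow> nat \<Rightarrow> nat" where
  "Q_mm d b n = card {P \<in> partitions n.
     \<forall>x \<in># P. ([int x = int b] (mod int (d + 3)) \<or> [int x = - int b] (mod int (d + 3)))
       \<and> x \<noteq> b \<and> int x \<noteq> int (d + 3) - int b}"

definition Delta_mm :: "nat \<Rightarrow> nat \<Rightarrow> nat \<Rightarrow> int" where
  "Delta_mm d a n = int (q d a n) - int (Q_mm d a n)"

end

theory Submission
  imports Defs "HOL-Analysis.Infinite_Products" "HOL-Library.Discrete_Functions"
    "HOL-Combinatorics.Multiset_Permutations"
begin

text \<open>
Write \<open>A = 2 ^ (a - 1)\<close>, so \<open>d = A m\<close> and \<open>a \<le> A\<close>. Multiplying the parts of a partition of \<open>n\<close> with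
differences at least \<open>m\<close> by \<open>A\<close> gives a partition counted by \<open>q d a (A n)\<close>. For every \<open>l\<close>, those with
\<open>l\<close> parts number at least \<open>1 / l!\<close> times the number of compositions of \<open>n - m l (l - 1) / 2\<close> into
\<open>l\<close> positive parts.

A partition counted by \<open>Q_mm d a (A n)\<close> has parts \<open>i (d + 3) \<plusminus> a\<close>; as \<open>A n\<close> is fixed, it is determined by
the parts with \<open>i \<ge> 2\<close>, and its indices \<open>i\<close> add up to at most \<open>K = 2 n / (2 m - 1)\<close>. Hence there are at most
\<open>x ^ (- K) (\<Prod>i\<ge>2. 1 - x ^ i) ^ (- 2)\<close> of them for every \<open>x\<close> in \<open>(0, 1)\<close>.

The first bound grows like \<open>exp (4.7 sqrt K)\<close> already for \<open>m = 32\<close> and \<open>l = sqrt K\<close>, the second like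
\<open>exp (3.7 sqrt K)\<close> for the best \<open>x\<close>. The comparison is made uniformly for \<open>K \<ge> 49\<close>, and for smaller
\<open>K\<close> with explicit \<open>x\<close> and \<open>l\<close> on seven ranges. Maximality of \<open>r\<close> and \<open>m \<noteq> 2 ^ (r - a + 1) - 1\<close> give \<open>m \<ge> 32\<close>
and \<open>n \<ge> 2 m + 33\<close>.
\<close>

section \<open>Partitions with large differences\<close>

lemma sorted_wrt_gap_mset:
  fixes d :: nat
  assumes "sorted_wrt (\<lambda>x y. x + d \<le> y) ys" "{#x, y#} \<subseteq># mset ys"
  shows "int d \<le> \<bar>int x - int y\<bar>"
  using assms
proof (induction ys)
  case Nil
  then show ?case by simp
next
  case (Cons z zs)
  consider "x = z" | "y = z" | "x \<noteq> z" "y \<noteq> z" by blast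
  then show ?case
  proof cases
    case 1
    then have "y \<in># mset zs" using Cons.prems(2) by simp
    then show ?thesis using Cons.prems(1) 1 by fastforce
  next
    case 2
    then have "{#z, x#} \<subseteq># add_mset z (mset zs)" using Cons.prems(2) by (simp add: add_mset_commute)
    then have "x \<in># mset zs" by simp
    then show ?thesis using Cons.prems(1) 2 by fastforce
  next
    case 3
    then have "z \<notin># {#x, y#}" by auto
    then have "{#x, y#} \<subseteq># mset zs"
      using Cons.prems(2) by (metis diff_single_trivial mset.simps(2) subset_eq_diff_conv add_mset_add_single)
    then show ?thesis using Cons by simp
  qed
qed

text \<open>For sorted \<open>xs\<close> the entries are the excesses over the staircase
  \<open>1, 1 + m, 1 + 2 m, ...\<close>. Scaling by \<open>A\<close> gives gaps of at least
  \<open>A m\<close> and parts of at least \<open>A\<close>.\<close>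

definition stair :: "nat \<Rightarrow> nat \<Rightarrow> nat list \<Rightarrow> nat list" where
  "stair A m xs = map (\<lambda>i. A * (xs ! i + 1 + m * i)) [0..<length xs]"

lemma length_stair [simp]: "length (stair A m xs) = length xs"
  by (simp add: stair_def)

lemma nth_stair: "i < length xs \<Longrightarrow> stair A m xs ! i = A * (xs ! i + 1 + m * i)"
  by (simp add: stair_def)

lemma sum_list_stair:
  "sum_list (stair A m xs) = A * (sum_list xs + length xs + m * (length xs * (length xs - 1) div 2))"
proof -
  have "sum_list (stair A m xs) = (\<Sum>i\<in>{0..<length xs}. A * (xs ! i + 1 + m * i))"
    by (simp add: stair_def interv_sum_list_conv_sum_set_nat)
  also have "\<dots> = A * ((\<Sum>i\<in>{0..<length xs}. xs ! i) + length xs + m * \<Sum>{0..<length xs})"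
    by (simp add: sum_distrib_left sum.distrib algebra_simps)
  also have "(\<Sum>i\<in>{0..<length xs}. xs ! i) = sum_list xs"
    by (simp add: sum_list_sum_nth)
  finally show ?thesis by (simp add: Sum_Ico_nat)
qed

lemma sorted_wrt_stair:
  assumes "sorted xs"
  shows "sorted_wrt (\<lambda>x y. x + A * m \<le> y) (stair A m xs)"
  unfolding sorted_wrt_iff_nth_less
proof (intro allI impI)
  fix i j assume ij: "i < j" "j < length (stair A m xs)"
  have "xs ! i \<le> xs ! j" using ij assms by (simp add: sorted_nth_mono)
  moreover have "m * i + m \<le> m * j" using ij mult_le_mono2[of "Suc i" j m] by simp
  ultimately have "A * (xs ! i + 1 + m * i + m) \<le> A * (xs ! j + 1 + m * j)"
    by (intro mult_le_mono2) linarith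
  then show "stair A m xs ! i + A * m \<le> stair A m xs ! j"
    using ij by (simp add: nth_stair algebra_simps)
qed

lemma inj_on_mset_stair:
  assumes "A > 0"
  shows "inj_on (\<lambda>xs. mset (stair A m xs)) {xs. sorted xs}"
proof (rule inj_onI)
  fix xs ys :: "nat list"
  assume s: "xs \<in> {xs. sorted xs}" "ys \<in> {xs. sorted xs}"
    and eq: "mset (stair A m xs) = mset (stair A m ys)"
  have "sorted (stair A m zs)" if "sorted zs" for zs
    using sorted_wrt_stair[OF that] by (rule sorted_wrt_mono_rel[rotated]) simp
  then have eq': "stair A m xs = stair A m ys"
    using s eq by (metis mem_Collect_eq sorted_list_of_multiset_mset sorted_sort_id)
  then have len: "length xs = length ys" by (metis length_stair)
  show "xs = ys"
  proof (rule nth_equalityI[OF len])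
    fix i assume "i < length xs"
    then show "xs ! i = ys ! i"
      using arg_cong[OF eq', of "\<lambda>zs. zs ! i"] len assms by (simp add: nth_stair)
  qed
qed

text \<open>A list is a rearrangement of its sorted version, and a multiset of size \<open>l\<close>
  has at most \<open>l!\<close> arrangements. Counting unsorted lists makes stars and bars
  available.\<close>

lemma card_lists_le_fact_card_sorted:
  "card {xs::nat list. length xs = l \<and> sum_list xs = N}
     \<le> fact l * card {xs. sorted xs \<and> length xs = l \<and> sum_list xs = N}"
    (is "card ?L \<le> _ * card ?S")
proof -
  have fin: "finite ?L"
  proof (rule finite_subset)
    show "?L \<subseteq> {xs. set xs \<subseteq> {..N} \<and> length xs = l}" using member_le_sum_list by fastforce
    show "finite {xs. set xs \<subseteq> {..N} \<and> length xs = l}"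
      by (rule finite_lists_length_eq) simp
  qed
  have finS: "finite ?S" by (rule finite_subset[OF _ fin]) auto
  have "?L \<subseteq> (\<Union>xs\<in>?S. permutations_of_multiset (mset xs))"
  proof
    fix xs assume "xs \<in> ?L"
    then have "sort xs \<in> ?S" by (simp flip: sum_mset_sum_list)
    moreover have "xs \<in> permutations_of_multiset (mset (sort xs))"
      by (simp add: permutations_of_multiset_def)
    ultimately show "xs \<in> (\<Union>xs\<in>?S. permutations_of_multiset (mset xs))" by blast
  qed
  then have "card ?L \<le> card (\<Union>xs\<in>?S. permutations_of_multiset (mset xs))"
    using finS by (intro card_mono) auto
  also have "\<dots> \<le> (\<Sum>xs\<in>?S. card (permutations_of_multiset (mset xs)))"
    by (rule card_UN_le[OF finS])
  also have "\<dots> \<le> (\<Sum>xs\<in>?S. fact l)"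
    by (intro sum_mono) (auto simp: card_permutations_of_multiset(1) intro: div_le_dividend)
  also have "\<dots> = fact l * card ?S" by simp
  finally show ?thesis .
qed

text \<open>By stars and bars \<open>X choose (l - 1)\<close> counts the compositions of
  \<open>X + 1\<close> into \<open>l\<close> positive parts, where \<open>X + 1\<close> is what
  remains of \<open>n\<close> without the shifts \<open>0, m, ..., (l - 1) m\<close>.\<close>

lemma q_lower_bound:
  assumes "0 < a" "a \<le> A" and X: "X + m * (l * (l - 1) div 2) + 1 = n" and l: "0 < l" "l \<le> X + 1"
  shows "X choose (l - 1) \<le> fact l * q (A * m) a (A * n)"
proof -
  define N where "N = X + 1 - l"
  let ?S = "{xs. sorted xs \<and> length xs = l \<and> sum_list xs = N}"
  let ?P = "{P \<in> partitions (A * n). (\<forall>x \<in># P. a \<le> x) \<and>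
     (\<forall>x y. {#x, y#} \<subseteq># P \<longrightarrow> int (A * m) \<le> \<bar>int x - int y\<bar>)}"
  have "(\<lambda>xs. mset (stair A m xs)) ` ?S \<subseteq> ?P"
  proof (intro image_subsetI CollectI conjI allI impI ballI)
    fix xs assume "xs \<in> ?S"
    then have xs: "sorted xs" "length xs = l" "sum_list xs = N" by auto
    show ge: "a \<le> x" if "x \<in># mset (stair A m xs)" for x
    proof -
      from that obtain i where "i < l" "x = A * (xs ! i + 1 + m * i)"
        using xs(2) by (auto simp: stair_def)
      then have "A \<le> x" by simp
      then show ?thesis using assms(2) by simp
    qed
    have "N + l + m * (l * (l - 1) div 2) = n" using X l by (simp add: N_def)
    then have "sum_list (stair A m xs) = A * n" by (simp add: sum_list_stair xs)
    then show "mset (stair A m xs) \<in> partitions (A * n)"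
      using ge assms(1) by (fastforce simp: partitions_def sum_mset_sum_list)
    show "int (A * m) \<le> \<bar>int x - int y\<bar>" if "{#x, y#} \<subseteq># mset (stair A m xs)" for x y
      using sorted_wrt_gap_mset[OF sorted_wrt_stair[OF xs(1)] that] .
  qed
  moreover have "finite ?P" by (rule finite_subset[OF _ finite_partitions]) blast
  moreover have "inj_on (\<lambda>xs. mset (stair A m xs)) ?S"
    by (rule inj_on_subset[OF inj_on_mset_stair]) (use assms in auto)
  ultimately have "card ?S \<le> q (A * m) a (A * n)"
    unfolding q_def using card_inj_on_le by blast
  moreover have "X choose (l - 1) = card {xs::nat list. length xs = l \<and> sum_list xs = N}"
  proof -
    have "N \<le> X" "X - N = l - 1" "N + l - 1 = X" using l by (simp_all add: N_def)
    then show ?thesis using binomial_symmetric[of N X] by (simp add: card_length_sum_list)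
  qed
  ultimately show ?thesis
    using card_lists_le_fact_card_sorted[of l N] mult_le_mono2[of "card ?S" "q (A * m) a (A * n)" "fact l"]
    by linarith
qed

section \<open>Partitions with parts congruent to \<open>\<plusminus> a\<close>\<close>

lemma sum_mset_image_eq_sum_count:
  fixes w :: "'a \<Rightarrow> nat"
  assumes "finite T" "set_mset M \<subseteq> T"
  shows "(\<Sum>t\<in>#M. w t) = (\<Sum>t\<in>T. w t * count M t)"
  using assms(2)
proof (induction M)
  case empty
  then show ?case by simp
next
  case (add x M)
  have "(\<Sum>t\<in>T. w t * count (add_mset x M) t) = (\<Sum>t\<in>T. w t * count M t + (if t = x then w t else 0))"
    by (intro sum.cong) auto
  also have "\<dots> = (\<Sum>t\<in>T. w t * count M t) + w x"
    using add.prems assms(1) by (simp add: sum.distrib)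
  finally show ?case using add by simp
qed

text \<open>Rankin's trick: a multiset of weight at most \<open>K\<close> contributes at least \<open>x ^ K\<close> to the expansion
  of \<open>\<Prod>t\<in>T. 1 / (1 - x ^ w t)\<close>.\<close>
lemma card_bounded_weight_multisets:
  fixes w :: "'a \<Rightarrow> nat" and x :: real and K :: nat
  assumes T: "finite T" and w: "\<And>t. t \<in> T \<Longrightarrow> 0 < w t" and x: "0 < x" "x < 1"
  defines "S \<equiv> {M. set_mset M \<subseteq> T \<and> (\<Sum>t\<in>#M. w t) \<le> K}"
  shows "finite S" and "card S * x ^ K * (\<Prod>t\<in>T. 1 - x ^ w t) \<le> 1"
proof -
  \<comment> \<open>Positive weights bound every multiplicity by \<open>K\<close>, so
    \<open>S\<close> embeds into the functions from \<open>T\<close> to \<open>{..K}\<close> and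
    only finite geometric sums occur.\<close>
  define \<phi> where "\<phi> = (\<lambda>M::'a multiset. restrict (count M) T)"
  let ?F = "PiE T (\<lambda>_. {..K})"
  have inj: "inj_on \<phi> S"
  proof (rule inj_onI)
    fix M M' assume M: "M \<in> S" "M' \<in> S" and eq: "\<phi> M = \<phi> M'"
    show "M = M'"
    proof (rule multiset_eqI)
      fix t
      show "count M t = count M' t"
      proof (cases "t \<in> T")
        case True
        then show ?thesis using fun_cong[OF eq, of t] by (simp add: \<phi>_def)
      next
        case False
        then have "t \<notin># M" "t \<notin># M'" using M by (auto simp: S_def)
        then show ?thesis by (simp add: not_in_iff)
      qed
    qed
  qed
  have sub: "\<phi> ` S \<subseteq> ?F"
  proof (rule image_subsetI)
    fix M assume M: "M \<in> S"
    have "count M t \<le> K" if t: "t \<in> T" for t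
    proof -
      have "count M t \<le> w t * count M t" using w[OF t] by simp
      also have "\<dots> \<le> (\<Sum>t\<in>T. w t * count M t)" using t T by (intro member_le_sum) auto
      also have "\<dots> \<le> K" using M sum_mset_image_eq_sum_count[OF T, of M w] by (simp add: S_def)
      finally show ?thesis .
    qed
    then show "\<phi> M \<in> ?F" by (auto simp: \<phi>_def)
  qed
  have finF: "finite ?F" using T by (intro finite_PiE) auto
  show fin: "finite S" using inj_on_finite[OF inj sub finF] .
  have pos: "0 < 1 - x ^ w t" if "t \<in> T" for t
    using w[OF that] x by (simp add: power_Suc_less_one power_less_one_iff)
  have "card S * x ^ K = (\<Sum>M\<in>S. x ^ K)" by simp
  also have "\<dots> \<le> (\<Sum>M\<in>S. \<Prod>t\<in>T. (x ^ w t) ^ \<phi> M t)"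
  proof (rule sum_mono)
    fix M assume M: "M \<in> S"
    have "x ^ K \<le> x ^ (\<Sum>t\<in>#M. w t)" using M x by (intro power_decreasing) (auto simp: S_def)
    also have "\<dots> = (\<Prod>t\<in>T. (x ^ w t) ^ \<phi> M t)"
      using M by (simp add: S_def sum_mset_image_eq_sum_count[OF T] power_sum power_mult \<phi>_def)
    finally show "x ^ K \<le> (\<Prod>t\<in>T. (x ^ w t) ^ \<phi> M t)" .
  qed
  also have "\<dots> = (\<Sum>g\<in>\<phi> ` S. \<Prod>t\<in>T. (x ^ w t) ^ g t)"
    using inj by (simp add: sum.reindex)
  also have "\<dots> \<le> (\<Sum>g\<in>?F. \<Prod>t\<in>T. (x ^ w t) ^ g t)"
    using x by (intro sum_mono2 finF sub prod_nonneg) auto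
  also have "\<dots> = (\<Prod>t\<in>T. \<Sum>c\<le>K. (x ^ w t) ^ c)"
    using T by (simp add: prod_sum_PiE)
  finally have le: "card S * x ^ K \<le> (\<Prod>t\<in>T. \<Sum>c\<le>K. (x ^ w t) ^ c)" .
  have "card S * x ^ K * (\<Prod>t\<in>T. 1 - x ^ w t) \<le>
      (\<Prod>t\<in>T. \<Sum>c\<le>K. (x ^ w t) ^ c) * (\<Prod>t\<in>T. 1 - x ^ w t)"
    using pos by (intro mult_right_mono le prod_nonneg) (auto intro: less_imp_le)
  also have "\<dots> = (\<Prod>t\<in>T. (1 - x ^ w t) * (\<Sum>c\<le>K. (x ^ w t) ^ c))"
    by (simp add: prod.distrib mult.commute)
  also have "\<dots> = (\<Prod>t\<in>T. 1 - (x ^ w t) ^ Suc K)"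
    by (simp only: sum_gp_basic)
  also have "\<dots> \<le> 1"
    using x by (intro prod_le_1) (auto intro!: power_le_one mult_le_one simp flip: power_mult power_add power_Suc)
  finally show "card S * x ^ K * (\<Prod>t\<in>T. 1 - x ^ w t) \<le> 1" .
qed

section \<open>Weights of the parts in the two residue classes\<close>

text \<open>The excluded parts are the smallest positive members of the two classes:
  \<open>a\<close> has index 0 and \<open>d + 3 - a\<close> has index 1. Hence the indices start at
  1 and 2.\<close>

lemma Q_mm_part_cases:
  assumes "0 < x" "0 < a" "2 * a < d + 3"
    and "[int x = int a] (mod int (d + 3)) \<or> [int x = - int a] (mod int (d + 3))"
    and "x \<noteq> a" "int x \<noteq> int (d + 3) - int a"
  shows "(\<exists>i\<ge>1. x = i * (d + 3) + a) \<or> (\<exists>i\<ge>2. x = i * (d + 3) - a)"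
proof -
  define D where "D = int (d + 3)"
  have D: "0 < D" "2 * int a < D" using assms(3) by (simp_all add: D_def)
  have lin: "\<exists>k. int x = b + D * k" if "[int x = b] (mod D)" for b
    using that cong_iff_lin[of b "int x" D] by (simp add: cong_sym)
  from assms(4) show ?thesis unfolding D_def[symmetric]
  proof
    assume "[int x = int a] (mod D)"
    then obtain k where k: "int x = int a + D * k" using lin by blast
    have "0 < k"
    proof (rule ccontr)
      assume "\<not> 0 < k"
      then have "k \<le> -1" using k assms(5) by (cases "k = 0") auto
      then have "D * k \<le> D * (-1)" using D by (intro mult_left_mono) auto
      then show False using k D by linarith
    qed
    then have "int x = int (nat k * (d + 3) + a)" using k by (simp add: D_def algebra_simps)
    then have "x = nat k * (d + 3) + a" by linarith
    moreover have "1 \<le> nat k" using \<open>0 < k\<close> by linarith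
    ultimately show ?thesis by blast
  next
    assume "[int x = - int a] (mod D)"
    then obtain k where k: "int x = - int a + D * k" using lin by blast
    have "1 < k"
    proof (rule ccontr)
      assume "\<not> 1 < k"
      then have "k \<le> 0" using k assms(6) by (cases "k = 1") (auto simp: D_def)
      then have "D * k \<le> 0" using D by (simp add: mult_nonneg_nonpos)
      then show False using k assms(1,2) by linarith
    qed
    then have "int (x + a) = int (nat k * (d + 3))" using k by (simp add: D_def algebra_simps)
    then have "x = nat k * (d + 3) - a" by linarith
    moreover have "2 \<le> nat k" using \<open>1 < k\<close> by linarith
    ultimately show ?thesis by blast
  qed
qed

text \<open>The weight of a part \<open>i (d + 3) \<plusminus> a\<close> is \<open>i\<close>. The only part of weight 1 is \<open>d + 3 + a\<close>; its
  multiplicity is determined by the other parts, so it contributes no factor to the product.\<close>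
lemma Q_mm_upper_bound:
  fixes x :: real
  assumes a: "0 < a" "2 * a < d + 3" and K: "2 * N < (K + 1) * (2 * (d + 3) - a)"
    and x: "0 < x" "x < 1"
  shows "Q_mm d a N * x ^ K * (\<Prod>i=2..K. 1 - x ^ i)\<^sup>2 \<le> 1"
proof -
  define D where "D = d + 3"
  \<comment> \<open>Adding \<open>a\<close> before dividing recovers \<open>i\<close> from both
    \<open>i D + a\<close> and \<open>i D - a\<close>, because \<open>2 a < D\<close>.\<close>
  define w where "w t = (t + a) div D" for t
  have aD: "2 * a < D" using a by (simp add: D_def)
  have wp: "w (i * D + a) = i" for i
    unfolding w_def using aD by (simp add: div_nat_eqI algebra_simps)
  have wm: "w (i * D - a) = i" if "1 \<le> i" for i
  proof -
    have "D \<le> i * D" using that by simp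
    then have "a \<le> i * D" using aD by linarith
    then show ?thesis unfolding w_def using aD by simp
  qed
  let ?Tp = "(\<lambda>i. i * D + a) ` {2..K}" and ?Tm = "(\<lambda>i. i * D - a) ` {2..K}"
  define T where "T = ?Tp \<union> ?Tm"
  define S where "S = {M. set_mset M \<subseteq> T \<and> (\<Sum>t\<in>#M. w t) \<le> K}"
  let ?Q = "{P \<in> partitions N.
     \<forall>x \<in># P. ([int x = int a] (mod int (d + 3)) \<or> [int x = - int a] (mod int (d + 3)))
       \<and> x \<noteq> a \<and> int x \<noteq> int (d + 3) - int a}"
  have part: "(\<exists>i\<ge>1. t = i * D + a) \<or> (\<exists>i\<ge>2. t = i * D - a)" if "P \<in> ?Q" "t \<in># P" for P t
  proof -
    have "0 < t" using that by (auto simp: partitions_def intro: gr0I)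
    moreover have "([int t = int a] (mod int (d + 3)) \<or> [int t = - int a] (mod int (d + 3)))
       \<and> t \<noteq> a \<and> int t \<noteq> int (d + 3) - int a"
      using that by blast
    ultimately show ?thesis
      unfolding D_def using a by (intro Q_mm_part_cases) simp_all
  qed
  \<comment> \<open>The ratio of part to weight is at least \<open>D - a / 2\<close>, with equality
    at the part \<open>2 D - a\<close>. Summed over the parts, this gives the form of the hypothesis
    \<open>K\<close>.\<close>
  have weight: "w t * (2 * D - a) \<le> 2 * t" if "P \<in> ?Q" "t \<in># P" for P t
    using part[OF that]
  proof (elim disjE exE conjE)
    fix i assume "1 \<le> i" "t = i * D + a"
    then show ?thesis using wp[of i] by (simp add: algebra_simps diff_mult_distrib2)
  next
    fix i assume i: "2 \<le> i" "t = i * D - a"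
    then have "2 * a \<le> i * a" by simp
    then have "i * (2 * D) - i * a \<le> i * (2 * D) - 2 * a" by (rule diff_le_mono2)
    then show ?thesis using i wm[of i] by (simp add: algebra_simps diff_mult_distrib2)
  qed
  have total: "(\<Sum>t\<in>#P. w t) \<le> K" if P: "P \<in> ?Q" for P
  proof -
    have "(\<Sum>t\<in>#P. w t) * (2 * D - a) = (\<Sum>t\<in>#P. w t * (2 * D - a))"
      by (simp add: sum_mset_distrib_right)
    also have "\<dots> \<le> (\<Sum>t\<in>#P. 2 * t)"
      by (rule sum_mset_mono) (rule weight[OF P])
    also have "\<dots> = 2 * N" using P by (simp add: partitions_def flip: sum_mset_distrib_left)
    also have "\<dots> < (K + 1) * (2 * D - a)" using K by (simp add: D_def)
    finally have "(\<Sum>t\<in>#P. w t) < K + 1" by (rule mult_right_less_imp_less) simp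
    then show ?thesis by simp
  qed
  let ?\<psi> = "filter_mset (\<lambda>t. 2 \<le> w t)"
  have sub: "?\<psi> ` ?Q \<subseteq> S"
  proof (rule image_subsetI)
    fix P assume P: "P \<in> ?Q"
    have wle: "w t \<le> K" if "t \<in># P" for t
    proof -
      have "w t \<le> (\<Sum>t\<in>#P. w t)" using that by (metis image_eqI set_image_mset sum_mset.remove le_add1)
      then show ?thesis using total[OF P] by simp
    qed
    have "t \<in> T" if t: "t \<in># P" "2 \<le> w t" for t
      using part[OF P t(1)] wle[OF t(1)] t(2) wp wm by (fastforce simp: T_def)
    moreover have "(\<Sum>t\<in>#?\<psi> P. w t) \<le> (\<Sum>t\<in>#P. w t)"
      by (metis image_mset_union le_add1 multiset_partition sum_mset.union)
    ultimately show "?\<psi> P \<in> S" using total[OF P] by (auto simp: S_def)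
  qed
  have inj: "inj_on ?\<psi> ?Q"
  proof (rule inj_onI)
    fix P P' assume P: "P \<in> ?Q" "P' \<in> ?Q" and eq: "?\<psi> P = ?\<psi> P'"
    have split: "\<exists>c. R = ?\<psi> R + replicate_mset c (D + a)" if R: "R \<in> ?Q" for R
    proof -
      have "t = D + a" if "t \<in># R" "\<not> 2 \<le> w t" for t
        using part[OF R that(1)]
      proof (elim disjE exE conjE)
        fix i assume "1 \<le> i" "t = i * D + a"
        then show ?thesis using that(2) wp[of i] by (cases "i = 1") auto
      next
        fix i assume "2 \<le> i" "t = i * D - a"
        then show ?thesis using that(2) wm[of i] by auto
      qed
      then have "set_mset (filter_mset (\<lambda>t. \<not> 2 \<le> w t) R) \<subseteq> {D + a}" by auto
      then have "\<exists>c. filter_mset (\<lambda>t. \<not> 2 \<le> w t) R = replicate_mset c (D + a)"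
        by (metis set_mset_subset_singletonD)
      then show ?thesis by (metis multiset_partition)
    qed
    obtain c where c: "P = ?\<psi> P + replicate_mset c (D + a)" using split[OF P(1)] ..
    obtain c' where c': "P' = ?\<psi> P + replicate_mset c' (D + a)" using split[OF P(2)] unfolding eq ..
    have "sum_mset P = N" "sum_mset P' = N" using P by (auto simp: partitions_def)
    moreover have "sum_mset P = sum_mset (?\<psi> P) + c * (D + a)"
      using arg_cong[OF c, of sum_mset] by simp
    moreover have "sum_mset P' = sum_mset (?\<psi> P) + c' * (D + a)"
      using arg_cong[OF c', of sum_mset] by simp
    ultimately have "c * (D + a) = c' * (D + a)" by linarith
    then have "c = c'" using aD by simp
    then show "P = P'" using c c' by metis
  qed
  have w_pos: "0 < w t" if "t \<in> T" for t
    using that wp wm by (force simp: T_def)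
  have finT: "finite T" by (simp add: T_def)
  note rankin = card_bounded_weight_multisets[of T w x K, OF finT w_pos x, folded S_def]
  have "(\<Prod>t\<in>T. 1 - x ^ w t) = (\<Prod>t\<in>?Tp. 1 - x ^ w t) * (\<Prod>t\<in>?Tm. 1 - x ^ w t)"
    unfolding T_def
  proof (rule prod.union_disjoint)
    \<comment> \<open>Equal parts have equal weights, hence equal indices, which
      \<open>a > 0\<close> rules out. So each index contributes two factors, whence the
      square.\<close>
    have "i * D + a \<noteq> j * D - a" if "2 \<le> j" for i j
    proof
      assume eq: "i * D + a = j * D - a"
      then have "i = j" using wp[of i] wm[of j] that by simp
      then show False using eq a(1) by simp
    qed
    then show "?Tp \<inter> ?Tm = {}" by auto
  qed auto
  also have "(\<Prod>t\<in>?Tp. 1 - x ^ w t) = (\<Prod>i=2..K. 1 - x ^ i)"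
    by (subst prod.reindex) (auto simp: wp intro!: inj_onI dest: arg_cong[of _ _ w])
  also have "(\<Prod>t\<in>?Tm. 1 - x ^ w t) = (\<Prod>i=2..K. 1 - x ^ i)"
  proof (subst prod.reindex)
    show "inj_on (\<lambda>i. i * D - a) {2..K}"
      by (rule inj_on_inverseI[where g = w]) (simp add: wm)
  qed (simp add: wm)
  finally have prod: "(\<Prod>t\<in>T. 1 - x ^ w t) = (\<Prod>i=2..K. 1 - x ^ i)\<^sup>2"
    by (simp add: power2_eq_square)
  have "Q_mm d a N \<le> card S"
    unfolding Q_mm_def by (rule card_inj_on_le[OF inj sub rankin(1)])
  then have "Q_mm d a N * x ^ K * (\<Prod>i=2..K. 1 - x ^ i)\<^sup>2
      \<le> card S * x ^ K * (\<Prod>i=2..K. 1 - x ^ i)\<^sup>2"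
    using x by (intro mult_right_mono) auto
  then show ?thesis using rankin(2) prod by simp
qed

section \<open>Bounds for the Euler product\<close>

text \<open>The first \<open>J\<close> factors are kept exactly; the others are bounded by the
  Weierstrass inequality and a geometric tail. This serves the explicit values of
  \<open>x\<close>.\<close>

lemma prod_one_minus_power_lower:
  fixes x :: real
  assumes x: "0 < x" "x < 1"
  shows "(\<Prod>i<J. 1 - x ^ (i + 2)) * (1 - x ^ (J + 2) / (1 - x)) \<le> (\<Prod>i=2..K. 1 - x ^ i)"
proof -
  have le1: "x ^ i \<le> 1" for i using x by (simp add: power_le_one)
  have pos: "0 \<le> (\<Prod>i\<in>A. 1 - x ^ i)" for A using le1 by (intro prod_nonneg) auto
  have head: "(\<Prod>i<J. 1 - x ^ (i + 2)) = (\<Prod>i=2..<J+2. 1 - x ^ i)"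
    by (rule prod.reindex_bij_witness[of _ "\<lambda>i. i - 2" "\<lambda>i. i + 2"]) auto
  have "(\<Sum>i=J+2..K. x ^ i) \<le> x ^ (J + 2) / (1 - x)"
    using x by (auto simp: sum_gp divide_simps)
  then have "1 - x ^ (J + 2) / (1 - x) \<le> 1 - (\<Sum>i=J+2..K. x ^ i)" by simp
  also have "\<dots> \<le> (\<Prod>i=J+2..K. 1 - x ^ i)"
    using le1 x by (intro Weierstrass_prod_ineq) auto
  finally have "(\<Prod>i<J. 1 - x ^ (i + 2)) * (1 - x ^ (J + 2) / (1 - x)) \<le>
      (\<Prod>i=2..<J+2. 1 - x ^ i) * (\<Prod>i=J+2..K. 1 - x ^ i)"
    unfolding head by (intro mult_left_mono pos)
  also have "\<dots> = (\<Prod>i\<in>{2..<J+2} \<union> {J+2..K}. 1 - x ^ i)"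
    by (rule prod.union_disjoint[symmetric]) auto
  also have "\<dots> = (\<Prod>i\<in>{2..<J+2} \<union> {J+2..K} - {2..K}. 1 - x ^ i) * (\<Prod>i=2..K. 1 - x ^ i)"
    by (rule prod.subset_diff) auto
  also have "\<dots> \<le> (\<Prod>i=2..K. 1 - x ^ i)"
    using x le1 by (intro mult_left_le_one_le prod_le_1 pos) auto
  finally show ?thesis .
qed

section \<open>The Euler product through its logarithm\<close>

text \<open>Telescoping with \<open>1 / (k + 1)^2 <= 1 / (k + 1/2) - 1 / (k + 3/2)\<close>; keeping
  the first term exact gives \<open>1 + 2/3\<close>, close to \<open>pi^2 / 6\<close>.\<close>

lemma sum_inverse_squares_le: "(\<Sum>k<n. 1 / (real k + 1)\<^sup>2) \<le> 5 / 3"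
proof (cases n)
  case (Suc n')
  have "(\<Sum>k<Suc n'. 1 / (real k + 1)\<^sup>2) \<le> 5 / 3 - 2 / (2 * real n' + 3)"
  proof (induction n')
    case (Suc n')
    have "1 / (real (Suc n') + 1)\<^sup>2 \<le> 2 / (2 * real n' + 3) - 2 / (2 * real (Suc n') + 3)"
      by (simp add: divide_simps) (simp add: power2_eq_square algebra_simps)
    then show ?case using Suc.IH by simp
  qed simp
  also have "\<dots> \<le> 5 / 3" by simp
  finally show ?thesis by (simp add: Suc)
qed simp

lemma sums_neg_ln_one_minus:
  fixes y :: real
  assumes "0 < y" "y < 1"
  shows "(\<lambda>k. y ^ Suc k / (real k + 1)) sums (- ln (1 - y))"
proof -
  have "summable (\<lambda>k. y ^ Suc k / (real k + 1))"
  proof (rule summable_comparison_test')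
    show "summable (\<lambda>k. y ^ Suc k)" using assms by (simp add: summable_geometric)
    show "norm (y ^ Suc k / (real k + 1)) \<le> y ^ Suc k" for k
      using assms by (simp add: divide_simps mult_left_mono)
  qed
  moreover have "ln (1 - y) = (\<Sum>k. - (y ^ Suc k / (real k + 1)))"
  proof -
    have "(- 1) ^ k * (1 / real (k + 1)) * (1 - y - 1) ^ Suc k = - (y ^ Suc k / (real k + 1))" for k
      by (cases "even k") (simp_all add: add.commute)
    then show ?thesis using ln_series[of "1 - y"] assms by simp
  qed
  ultimately show ?thesis by (simp add: suminf_minus summable_sums)
qed

text \<open>For \<open>z = x ^ (k + 1)\<close> the sum is at most \<open>z / (1 - z)\<close>, and
  \<open>1 - z = (1 - x) (1 + x + ... + x ^ k)\<close> is at least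
  \<open>(1 - x) (k + 1) x ^ k\<close>.\<close>

lemma geometric_tail_le:
  fixes x :: real
  assumes x: "0 < x" "x < 1"
  shows "(\<Sum>i=1..K. (x ^ i) ^ Suc k) \<le> x / (1 - x) / (real k + 1)"
proof -
  let ?z = "x ^ Suc k"
  have z: "0 < ?z" "?z < 1" using x by (simp_all add: power_Suc_less_one del: power_Suc)
  have "(\<Sum>i=1..K. (x ^ i) ^ Suc k) = (\<Sum>i=1..K. ?z ^ i)"
    by (intro sum.cong refl) (simp only: power_mult[symmetric] mult.commute)
  also have "\<dots> \<le> ?z / (1 - ?z)"
  proof -
    have "(\<Sum>i=1..K. z ^ i) \<le> z / (1 - z)" if "0 < z" "z < 1" for z :: real
      using that by (subst sum_gp) (simp add: divide_simps)
    then show ?thesis using z by blast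
  qed
  also have "\<dots> \<le> x / (1 - x) / (real k + 1)"
  proof -
    have "(real k + 1) * x ^ k = (\<Sum>i\<le>k. x ^ k)" by simp
    also have "\<dots> \<le> (\<Sum>i\<le>k. x ^ i)" using x by (intro sum_mono power_decreasing) auto
    finally have "(1 - x) * ((real k + 1) * x ^ k) \<le> (1 - x) * (\<Sum>i\<le>k. x ^ i)"
      using x by (intro mult_left_mono) auto
    also have "\<dots> = 1 - ?z" by (simp only: sum_gp_basic)
    finally have "x * ((1 - x) * ((real k + 1) * x ^ k)) \<le> x * (1 - ?z)"
      using x by (intro mult_left_mono) auto
    then have "?z * ((1 - x) * (real k + 1)) \<le> x * (1 - ?z)" by (simp add: algebra_simps)
    moreover have "u / v \<le> x / b / c" if "u * (b * c) \<le> x * v" "0 < v" "0 < b" "0 < c" for u v b c :: real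
      using that by (simp add: field_simps)
    ultimately show ?thesis using x z by simp
  qed
  finally show ?thesis .
qed

text \<open>Expanding the logarithms and exchanging the sums leaves \<open>x / (1 - x)\<close> times
  a sum of inverse squares; \<open>5 / 3\<close> replaces the classical
  \<open>pi^2 / 6\<close>.\<close>

lemma prod_one_minus_power_ge_exp:
  fixes x :: real
  assumes x: "0 < x" "x < 1"
  shows "exp (- (5 / 3 * (x / (1 - x)))) \<le> (\<Prod>i=1..K. 1 - x ^ i)"
proof -
  let ?c = "x / (1 - x)"
  have c: "0 < ?c" using x by simp
  have xi: "0 < x ^ i" "x ^ i < 1" if "i \<in> {1..K}" for i
    using that x by (auto simp: power_less_one_iff)
  have "(\<lambda>k. \<Sum>i=1..K. (x ^ i) ^ Suc k / (real k + 1)) sums (\<Sum>i=1..K. - ln (1 - x ^ i))"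
    by (intro sums_sum sums_neg_ln_one_minus xi)
  then have lim: "(\<lambda>n. \<Sum>k<n. \<Sum>i=1..K. (x ^ i) ^ Suc k / (real k + 1)) \<longlonglongrightarrow> (\<Sum>i=1..K. - ln (1 - x ^ i))"
    by (simp add: sums_def)
  have "(\<Sum>k<n. \<Sum>i=1..K. (x ^ i) ^ Suc k / (real k + 1)) \<le> 5 / 3 * ?c" for n
  proof -
    have "(\<Sum>k<n. \<Sum>i=1..K. (x ^ i) ^ Suc k / (real k + 1)) \<le> (\<Sum>k<n. ?c * (1 / (real k + 1)\<^sup>2))"
    proof (rule sum_mono)
      fix k
      have "(\<Sum>i=1..K. (x ^ i) ^ Suc k / (real k + 1)) = (\<Sum>i=1..K. (x ^ i) ^ Suc k) / (real k + 1)"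
        by (simp add: sum_divide_distrib)
      also have "\<dots> \<le> ?c / (real k + 1) / (real k + 1)"
        by (intro divide_right_mono geometric_tail_le x) simp
      finally show "(\<Sum>i=1..K. (x ^ i) ^ Suc k / (real k + 1)) \<le> ?c * (1 / (real k + 1)\<^sup>2)"
        by (simp only: power2_eq_square divide_divide_eq_left times_divide_eq_right mult_1_right mult.assoc)
    qed
    also have "\<dots> = ?c * (\<Sum>k<n. 1 / (real k + 1)\<^sup>2)" by (rule sum_distrib_left[symmetric])
    also have "\<dots> \<le> ?c * (5 / 3)" by (intro mult_left_mono sum_inverse_squares_le) (use c in simp)
    finally show ?thesis by (simp only: mult.commute)
  qed
  then have "(\<Sum>i=1..K. - ln (1 - x ^ i)) \<le> 5 / 3 * ?c"
    by (intro LIMSEQ_le_const2[OF lim]) auto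
  then have "exp (- (5 / 3 * ?c)) \<le> exp (\<Sum>i=1..K. ln (1 - x ^ i))"
    by (simp add: sum_negf)
  also have "\<dots> = (\<Prod>i=1..K. 1 - x ^ i)"
    using xi by (simp add: exp_sum)
  finally show ?thesis .
qed

section \<open>Comparison\<close>

text \<open>All \<open>k\<close> factors of \<open>X (X - 1) ... (X - k + 1)\<close> are at least
  \<open>Y\<close>.\<close>

lemma power_le_fact_mult_binomial:
  assumes "Y + k \<le> X + 1"
  shows "Y ^ k \<le> fact k * (X choose k)"
proof -
  have "real Y ^ k = (\<Prod>i=0..<k. real Y)" by simp
  also have "\<dots> \<le> (\<Prod>i=0..<k. real X - real i)"
    using assms by (intro prod_mono) auto
  also have "\<dots> = fact k * real (X choose k)"
    by (simp add: binomial_gbinomial gbinomial_prod_rev)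
  finally have "real (Y ^ k) \<le> real (fact k * (X choose k))" by simp
  then show ?thesis by (simp only: of_nat_le_iff)
qed

text \<open>Here \<open>q\<close> is at least \<open>Y ^ (l - 1) / (l! (l - 1)!)\<close> and
  \<open>Q_mm\<close> at most \<open>1 / (x ^ K p^2)\<close>; \<open>bound\<close> compares the two,
  with the parameters left free.\<close>

lemma Q_mm_le_q:
  fixes x p :: real
  assumes a: "0 < a" "a \<le> A" and m: "2 \<le> m"
    and K: "2 * n < (K + 1) * (2 * m - 1)"
    and Y: "Y + l + m * (l * (l - 1) div 2) \<le> n + 1" "0 < Y" and l: "0 < l"
    and x: "0 < x" "x < 1" and p: "0 \<le> p" "p \<le> (\<Prod>i=2..K. 1 - x ^ i)"
    and bound: "fact l * fact (l - 1) \<le> real Y ^ (l - 1) * x ^ K * p\<^sup>2"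
  shows "Q_mm (A * m) a (A * n) \<le> q (A * m) a (A * n)"
proof -
  let ?Q = "Q_mm (A * m) a (A * n)" and ?q = "q (A * m) a (A * n)"
  define P where "P = (\<Prod>i=2..K. 1 - x ^ i)"
  define X where "X = n - m * (l * (l - 1) div 2) - 1"
  have X: "X + m * (l * (l - 1) div 2) + 1 = n" "l \<le> X + 1" "Y + (l - 1) \<le> X + 1"
    using Y l unfolding X_def by linarith+
  have "Y ^ (l - 1) \<le> fact (l - 1) * (X choose (l - 1))"
    by (rule power_le_fact_mult_binomial) (rule X(3))
  also have "\<dots> \<le> fact (l - 1) * (fact l * ?q)"
    by (intro mult_le_mono2 q_lower_bound a X l)
  finally have q: "real Y ^ (l - 1) \<le> fact l * fact (l - 1) * ?q"
    by (simp only: of_nat_le_iff[where 'a = real, symmetric]) (simp add: mult_ac)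
  have Am: "2 * A \<le> A * m" using m by simp
  \<comment> \<open>Multiplying by \<open>A\<close> and using \<open>a <= A\<close> turns a
    condition on \<open>n\<close>, \<open>m\<close> and \<open>K\<close> into the one required for
    \<open>Q_mm\<close>.\<close>
  have "A * (2 * n) < A * ((K + 1) * (2 * m - 1))" using K a by (intro mult_strict_left_mono) auto
  also have "\<dots> = (K + 1) * (2 * (A * m) - A)"
    by (simp add: diff_mult_distrib2 algebra_simps)
  also have "\<dots> \<le> (K + 1) * (2 * (A * m + 3) - a)"
  proof (rule mult_le_mono2)
    have "2 * B - A \<le> 2 * (B + 3) - a" if "2 * A \<le> B" for B using that a by presburger
    then show "2 * (A * m) - A \<le> 2 * (A * m + 3) - a" using Am .
  qed
  finally have "2 * (A * n) < (K + 1) * (2 * (A * m + 3) - a)" by (simp only: mult.left_commute)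
  then have Q: "?Q * x ^ K * P\<^sup>2 \<le> 1"
    unfolding P_def using a Am x by (intro Q_mm_upper_bound) linarith+
  have "real ?Q * (fact l * fact (l - 1)) \<le> ?Q * (real Y ^ (l - 1) * x ^ K * p\<^sup>2)"
    by (intro mult_left_mono bound) simp
  also have "\<dots> \<le> ?Q * (real Y ^ (l - 1) * x ^ K * P\<^sup>2)"
    using p x by (intro mult_left_mono power_mono) (auto simp: P_def)
  also have "\<dots> = real Y ^ (l - 1) * (?Q * x ^ K * P\<^sup>2)" by (simp only: mult_ac)
  also have "\<dots> \<le> real Y ^ (l - 1) * 1" by (intro mult_left_mono Q) simp
  also have "\<dots> \<le> real ?q * (fact l * fact (l - 1))" using q by (simp add: mult_ac)
  finally have "real ?Q \<le> real ?q" by (rule mult_right_le_imp_le) simp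
  then show ?thesis by simp
qed

text \<open>With \<open>K\<^sub>0 \<le> 2 n / (2 m - 1) < K\<^sub>1 + 1\<close> there is room for \<open>l\<close> distant parts already when
  \<open>m = 32\<close>, which is what the hypothesis on \<open>Y\<close> says.\<close>
lemma Q_mm_le_q_range:
  fixes x :: real
  assumes a: "0 < a" "a \<le> A" and m: "32 \<le> m"
    and K: "K\<^sub>0 * (2 * m - 1) \<le> 2 * n" "2 * n < (K\<^sub>1 + 1) * (2 * m - 1)"
    and Y: "2 * Y + 2 * l + K\<^sub>0 + 64 * (l * (l - 1) div 2) \<le> 64 * K\<^sub>0 + 3" "l * (l - 1) div 2 \<le> K\<^sub>0"
      "0 < Y" "0 < l"
    and x: "0 < x" "x < 1" and p: "0 \<le> p" "p \<le> (\<Prod>i=2..K\<^sub>1. 1 - x ^ i)"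
    and bound: "fact l * fact (l - 1) \<le> real Y ^ (l - 1) * x ^ K\<^sub>1 * p\<^sup>2"
  shows "Q_mm (A * m) a (A * n) \<le> q (A * m) a (A * n)"
proof (rule Q_mm_le_q[OF a _ K(2) _ Y(3,4) x p bound])
  define c where "c = l * (l - 1) div 2"
  obtain e where e: "K\<^sub>0 = c + e" using Y(2) le_Suc_ex unfolding c_def by blast
  \<comment> \<open>Twice the room left by the staircase is at least
    \<open>2 m e - K\<^sub>0\<close>, which is smallest at \<open>m = 32\<close>. The
    \<open>3\<close> in the hypothesis is \<open>2 + 1\<close>, the extra 1 being free by
    parity.\<close>
  have "64 * e \<le> 2 * m * e" using m by simp
  moreover have "K\<^sub>0 * (2 * m) \<le> 2 * n + K\<^sub>0" using K(1) by (simp add: diff_mult_distrib2)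
  moreover have "K\<^sub>0 * (2 * m) = 2 * (m * c) + 2 * m * e" by (simp add: e algebra_simps)
  ultimately have "Y + l + m * c \<le> n + 1" using Y(1) e unfolding c_def[symmetric] by linarith
  then show "Y + l + m * (l * (l - 1) div 2) \<le> n + 1" unfolding c_def .
qed (use m in simp)

section \<open>Explicit parameters for small \<open>n / m\<close>\<close>

text \<open>In the last six ranges \<open>K\<^sub>0\<close> and \<open>K\<^sub>1 + 1\<close> are the
  ends, and \<open>Y\<close> is the largest integer that the condition on the room allows.
  \<open>x\<close> moves towards 1 as the weights grow.\<close>

lemma Q_mm_le_q_small:
  assumes a: "0 < a" "a \<le> A" and m: "32 \<le> m"
    and n: "2 * m + 33 \<le> n" "2 * n < 49 * (2 * m - 1)"
  shows "Q_mm (A * m) a (A * n) \<le> q (A * m) a (A * n)"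
proof -
  let ?M = "2 * m - 1"
  consider "2 * n < 4 * ?M" | "4 * ?M \<le> 2 * n" "2 * n < 5 * ?M"
    | "5 * ?M \<le> 2 * n" "2 * n < 8 * ?M" | "8 * ?M \<le> 2 * n" "2 * n < 12 * ?M"
    | "12 * ?M \<le> 2 * n" "2 * n < 19 * ?M" | "19 * ?M \<le> 2 * n" "2 * n < 31 * ?M"
    | "31 * ?M \<le> 2 * n"
    by linarith
  then show ?thesis
  proof cases
    case 1
    \<comment> \<open>\<open>Y = 64\<close> comes from \<open>n >= 2 m + 33\<close> and
      \<open>m >= 32\<close>. The bound is then an equality:
      \<open>2 = 64 (1/2)^3 (1/2)^2\<close>.\<close>
    show ?thesis
      by (rule Q_mm_le_q[where K = 3 and Y = 64 and l = 2 and x = "1/2", OF a _ _ _ _ _ _ _ _ prod_one_minus_power_lower[where J = 0]])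
        (use 1 n m in \<open>simp_all add: power2_eq_square power_divide\<close>)
  next
    case 2
    show ?thesis
      by (rule Q_mm_le_q_range[where K\<^sub>0 = 4 and K\<^sub>1 = 4 and Y = 28 and l = 3 and x = "1/2",
          OF a m _ _ _ _ _ _ _ _ _ prod_one_minus_power_lower[where J = 0]])
        (use 2 in \<open>simp_all add: power2_eq_square power_divide fact_numeral\<close>)
  next
    case 3
    show ?thesis
      by (rule Q_mm_le_q_range[where K\<^sub>0 = 5 and K\<^sub>1 = 7 and Y = 60 and l = 3 and x = "4/7",
          OF a m _ _ _ _ _ _ _ _ _ prod_one_minus_power_lower[where J = 2]])
        (use 3 in \<open>simp_all add: power2_eq_square power_divide fact_numeral lessThan_nat_numeral\<close>)
  next
    case 4
    show ?thesis
      by (rule Q_mm_le_q_range[where K\<^sub>0 = 8 and K\<^sub>1 = 11 and Y = 154 and l = 3 and x = "5/8",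
          OF a m _ _ _ _ _ _ _ _ _ prod_one_minus_power_lower[where J = 5]])
        (use 4 in \<open>simp_all add: power2_eq_square power_divide fact_numeral lessThan_nat_numeral\<close>)
  next
    case 5
    show ?thesis
      by (rule Q_mm_le_q_range[where K\<^sub>0 = 12 and K\<^sub>1 = 18 and Y = 183 and l = 4 and x = "2/3",
          OF a m _ _ _ _ _ _ _ _ _ prod_one_minus_power_lower[where J = 3]])
        (use 5 in \<open>simp_all add: power2_eq_square power_divide fact_numeral lessThan_nat_numeral\<close>)
  next
    case 6
    show ?thesis
      by (rule Q_mm_le_q_range[where K\<^sub>0 = 19 and K\<^sub>1 = 30 and Y = 275 and l = 5 and x = "3/4",
          OF a m _ _ _ _ _ _ _ _ _ prod_one_minus_power_lower[where J = 6]])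
        (use 6 in \<open>simp_all add: power2_eq_square power_divide fact_numeral lessThan_nat_numeral\<close>)
  next
    case 7
    show ?thesis
      by (rule Q_mm_le_q_range[where K\<^sub>0 = 31 and K\<^sub>1 = 48 and Y = 492 and l = 6 and x = "4/5",
          OF a m _ _ _ _ _ _ _ _ _ prod_one_minus_power_lower[where J = 8]])
        (use 7 n in \<open>simp_all add: power2_eq_square power_divide fact_numeral lessThan_nat_numeral\<close>)
  qed
qed

section \<open>Uniform comparison for large \<open>n / m\<close>\<close>

text \<open>Passing to \<open>k + 1\<close> multiplies the left side by
  \<open>79/2 (k + 2) (k + 1)\<close>. On the right, \<open>Y(k + 1) / Y(k) >= (1 + 1/k)^2\<close>
  and \<open>(1 + 1/k)^k >= 2\<close> give a factor of at least \<open>4 Y(k + 1)\<close>.\<close>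

lemma fact_mult_fact_mult_power_le:
  assumes "7 \<le> k"
  shows "fact (Suc k) * fact k * (79 / 2) ^ Suc k \<le> 29 * (real k * (31 * real k - 35) / 2) ^ k"
  using assms
proof (induction k rule: dec_induct)
  case base
  show ?case by (simp add: fact_numeral power_divide)
next
  case (step k)
  let ?Y = "\<lambda>k. k * (31 * k - 35) / 2 :: real" and ?k = "real k"
  have k: "7 \<le> ?k" using step by simp
  have Y0: "0 \<le> ?Y ?k" using k by simp
  have ratio: "?Y ?k * (1 + 1 / ?k)\<^sup>2 \<le> ?Y (?k + 1)"
  proof -
    have "(?k + 1) * (31 * ?k - 35) \<le> ?k * (31 * ?k - 4)" by (simp add: algebra_simps)
    then have "(?k + 1) * ((?k + 1) * (31 * ?k - 35)) \<le> (?k + 1) * (?k * (31 * ?k - 4))"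
      using k by (intro mult_left_mono) auto
    then show ?thesis using k by (simp add: field_simps power2_eq_square)
  qed
  have bernoulli: "2 \<le> (1 + 1 / ?k) ^ k"
    using Bernoulli_inequality[of "1 / ?k" k] k by (simp add: order_trans[of "- 1" 0])
  have "4 * ?Y ?k ^ k \<le> ((1 + 1 / ?k) ^ k)\<^sup>2 * ?Y ?k ^ k"
    using power_mono[OF bernoulli, of 2] Y0 by (intro mult_right_mono) auto
  also have "\<dots> = (?Y ?k * (1 + 1 / ?k)\<^sup>2) ^ k"
    by (simp only: power_mult_distrib power_mult[symmetric] mult_ac)
  also have "\<dots> \<le> ?Y (?k + 1) ^ k"
    using ratio Y0 by (intro power_mono) auto
  finally have growth: "4 * ?Y ?k ^ k \<le> ?Y (?k + 1) ^ k" .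
  have factor: "79 / 2 * ((?k + 2) * (?k + 1)) \<le> 4 * ?Y (?k + 1)"
  proof -
    have "79 / 2 * (?k + 2) \<le> 2 * (31 * ?k - 4)" using k by simp
    then have "(?k + 1) * (79 / 2 * (?k + 2)) \<le> (?k + 1) * (2 * (31 * ?k - 4))"
      using k by (intro mult_left_mono) auto
    moreover have "4 * ?Y (?k + 1) = (?k + 1) * (2 * (31 * ?k - 4))" by (simp add: field_simps)
    ultimately show ?thesis by (simp only: mult_ac)
  qed
  have "fact (Suc (Suc k)) * fact (Suc k) * (79 / 2) ^ Suc (Suc k)
      = 79 / 2 * ((?k + 2) * (?k + 1)) * (fact (Suc k) * fact k * (79 / 2) ^ Suc k)"
    by (simp add: field_simps)
  also have "\<dots> \<le> (4 * ?Y (?k + 1)) * (29 * ?Y ?k ^ k)"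
    by (rule mult_mono[OF factor step.IH]) (use k in auto)
  also have "\<dots> = 29 * ?Y (?k + 1) * (4 * ?Y ?k ^ k)" by (simp only: mult_ac)
  also have "\<dots> \<le> 29 * ?Y (?k + 1) * ?Y (?k + 1) ^ k"
    using growth k by (intro mult_left_mono) auto
  finally show ?case by (simp add: mult.assoc add.commute)
qed

lemma exp_11_thirds_le: "exp (11 / 3 :: real) \<le> 79 / 2"
proof -
  have "exp (11 / 3 :: real) ^ 3 = exp 1 ^ 11" by (simp flip: exp_of_nat_mult)
  also have "\<dots> \<le> (272 / 100) ^ 11" using e_less_272 by (intro power_mono) auto
  also have "\<dots> \<le> (79 / 2 :: real) ^ 3" by (simp add: power_divide)
  finally show ?thesis by (subst (asm) power_mono_iff) simp_all
qed

text \<open>The choice \<open>x = u / (1 + u)\<close> with \<open>u = 11 l / 20\<close> nearly minimises the exponent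
  \<open>K / u + 10 u / 3\<close> at \<open>K = l\<^sup>2\<close>, where it is \<open>(20 / 11 + 11 / 6) l < 11 l / 3\<close>.\<close>
lemma Q_mm_le_q_large:
  assumes a: "0 < a" "a \<le> A" and m: "32 \<le> m" and l: "8 \<le> l"
    and n: "(l - 1)\<^sup>2 * (2 * m - 1) \<le> 2 * n" "2 * n < l\<^sup>2 * (2 * m - 1)"
  shows "Q_mm (A * m) a (A * n) \<le> q (A * m) a (A * n)"
proof -
  obtain k where k: "l = Suc k" "7 \<le> k" using l by (cases l) auto
  \<comment> \<open>With \<open>K\<^sub>0 = k^2\<close> and \<open>l = k + 1\<close> the room allows
    \<open>2 Y <= 31 k^2 - 34 k + 1\<close>; taking \<open>35 k\<close> makes the product even for
    every \<open>k\<close>.\<close>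
  define Y where "Y = k * (31 * k - 35) div 2"
  have even: "even (k * (31 * k - 35))" using k by (cases "even k") auto
  then have Y2: "2 * Y = k * (31 * k - 35)" unfolding Y_def by simp
  have Y: "real Y = real k * (31 * real k - 35) / 2"
  proof -
    have "2 * real Y = real (k * (31 * k - 35))" by (simp flip: Y2)
    then show ?thesis using k by (simp add: of_nat_diff)
  qed
  \<comment> \<open>The factor \<open>1 + u = 1 / (1 - x)\<close> in \<open>p\<close> cancels the
    factor \<open>i = 1\<close> of the Euler product.\<close>
  define u x p :: real where "u = 11 * real l / 20" and "x = u / (1 + u)"
    and "p = exp (- (5 / 3 * u)) * (1 + u)"
  have u: "22 / 5 \<le> u" using l by (simp add: u_def)
  have x: "0 < x" "x < 1" "x / (1 - x) = u" "(1 - x) * (1 + u) = 1"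
    using u by (simp_all add: x_def field_simps)
  have p: "p \<le> (\<Prod>i=2..l\<^sup>2. 1 - x ^ i)"
  proof -
    have "exp (- (5 / 3 * u)) \<le> (\<Prod>i=1..l\<^sup>2. 1 - x ^ i)"
      using prod_one_minus_power_ge_exp[OF x(1,2)] by (simp only: x(3))
    also have "\<dots> = (1 - x) * (\<Prod>i=2..l\<^sup>2. 1 - x ^ i)"
      using l by (subst prod.atLeast_Suc_atMost) (auto simp: numeral_2_eq_2)
    finally have "p \<le> (1 - x) * (\<Prod>i=2..l\<^sup>2. 1 - x ^ i) * (1 + u)"
      unfolding p_def using u by (intro mult_right_mono) auto
    also have "\<dots> = ((1 - x) * (1 + u)) * (\<Prod>i=2..l\<^sup>2. 1 - x ^ i)" by (simp only: mult_ac)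
    finally show ?thesis by (simp only: x(4) mult_1_left)
  qed
  \<comment> \<open>\<open>79 / 2\<close> bounds \<open>exp (11 / 3)\<close>, and \<open>29\<close>
    is below \<open>(27 / 5)^2 <= (1 + u)^2\<close>, which holds from \<open>l = 8\<close>
    on.\<close>
  have "(2 / 79) ^ l * 29 \<le> x ^ l\<^sup>2 * p\<^sup>2"
  proof -
    have "exp (- (1 / u)) \<le> x"
    proof -
      have "1 / x = 1 + 1 / u" using u by (simp add: x_def field_simps)
      also have "\<dots> \<le> exp (1 / u)" by (rule exp_ge_add_one_self)
      finally show ?thesis using x u by (simp add: exp_minus field_simps)
    qed
    then have "exp (- (1 / u)) ^ l\<^sup>2 \<le> x ^ l\<^sup>2" by (intro power_mono) auto
    moreover have "exp (- (1 / u)) ^ l\<^sup>2 = exp (- (20 / 11 * real l))"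
      using l by (simp add: u_def power2_eq_square flip: exp_of_nat_mult)
    ultimately have 1: "exp (- (20 / 11 * real l)) \<le> x ^ l\<^sup>2" by simp
    have "(22 / 5 + 1)\<^sup>2 \<le> (1 + u)\<^sup>2" using u by (intro power_mono) auto
    then have 2: "29 \<le> (1 + u)\<^sup>2" by (simp add: power2_eq_square)
    have 3: "p\<^sup>2 = exp (- (11 / 6 * real l)) * (1 + u)\<^sup>2"
      unfolding p_def power_mult_distrib by (simp add: u_def flip: exp_of_nat_mult)
    have "2 / 79 \<le> exp (- (11 / 3 :: real))"
      using exp_11_thirds_le by (simp add: exp_minus field_simps)
    then have "(2 / 79) ^ l \<le> exp (- (11 / 3 :: real)) ^ l" by (intro power_mono) auto
    also have "\<dots> \<le> exp (- (20 / 11 * real l)) * exp (- (11 / 6 * real l))"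
      by (simp flip: exp_of_nat_mult exp_add)
    finally have "(2 / 79) ^ l * 29 \<le> exp (- (20 / 11 * real l)) * exp (- (11 / 6 * real l)) * (1 + u)\<^sup>2"
      using 2 by (intro mult_mono) auto
    also have "\<dots> = exp (- (20 / 11 * real l)) * p\<^sup>2" by (simp add: 3)
    also have "\<dots> \<le> x ^ l\<^sup>2 * p\<^sup>2" using 1 by (intro mult_right_mono) auto
    finally show ?thesis .
  qed
  then have "real Y ^ k * ((2 / 79) ^ l * 29) \<le> real Y ^ k * (x ^ l\<^sup>2 * p\<^sup>2)"
    by (intro mult_left_mono) auto
  moreover have "fact l * fact k \<le> real Y ^ k * ((2 / 79) ^ l * 29)"
  proof -
    have "(fact l * fact k :: real) = fact l * fact k * (79 / 2) ^ l * (2 / 79) ^ l"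
      by (simp flip: power_mult_distrib)
    also have "\<dots> \<le> 29 * real Y ^ k * (2 / 79) ^ l"
      using fact_mult_fact_mult_power_le[OF k(2)]
      by (intro mult_right_mono) (simp_all only: k(1) Y zero_le_power zero_le_divide_iff zero_le_numeral simp_thms)
    finally show ?thesis by (simp only: mult_ac)
  qed
  ultimately have bound: "fact l * fact (l - 1) \<le> real Y ^ (l - 1) * x ^ l\<^sup>2 * p\<^sup>2"
    by (simp add: k(1) mult.assoc)
  show ?thesis
  proof (rule Q_mm_le_q_range[OF a m n(1) _ _ _ _ _ x(1,2) _ p bound])
    show "2 * n < (l\<^sup>2 + 1) * (2 * m - 1)" using n(2) unfolding add_mult_distrib by linarith
    have tri: "2 * (l * (l - 1) div 2) = k * k + k" using k(1) by simp
    have sq: "(l - 1)\<^sup>2 = k * k" using k(1) by (simp add: power2_eq_square)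
    have "k \<le> k * k" using k by simp
    then show "l * (l - 1) div 2 \<le> (l - 1)\<^sup>2" using tri sq by linarith
    have "2 * Y + 35 * k = 31 * (k * k)" using k Y2 by (simp add: diff_mult_distrib2)
    then show "2 * Y + 2 * l + (l - 1)\<^sup>2 + 64 * (l * (l - 1) div 2) \<le> 64 * (l - 1)\<^sup>2 + 3"
      using tri sq k by linarith
    have "0 < k * (31 * k - 35)" using k by simp
    then have "0 < 2 * Y" by (simp only: Y2)
    then show "0 < Y" by simp
  qed (use l u in \<open>auto simp: p_def\<close>)
qed

theorem theorem1p7:
  fixes a d m r n :: nat
  assumes "a \<ge> 3"
    and "m \<ge> 31"
    and "d = 2 ^ (a - 1) * m"
    and "(2::int) ^ r - 2 ^ (a - 1) \<le> int d"
    and "\<And>s::nat. (2::int) ^ s - 2 ^ (a - 1) \<le> int d \<Longrightarrow> s \<le> r"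
    and "int m \<noteq> 2 ^ (r - a + 1) - 1"
    and "n \<ge> 2 * m + 2 ^ (r - a + 1) + 1"
  shows "Delta_mm d a (2 ^ (a - 1) * n) \<ge> 0"
proof -
  define A :: nat where "A = 2 ^ (a - 1)"
  have a: "0 < a" "a \<le> A"
    using assms(1) less_exp[of "a - 1"] unfolding A_def by linarith+
  have A: "int A = 2 ^ (a - 1)" "0 < A" by (simp_all add: A_def)
  have pow: "(2::int) ^ (s + (a - 1)) = 2 ^ s * int A" for s by (simp add: A power_add)
  have d: "int d = int A * int m" by (simp add: assms(3) A_def)
  \<comment> \<open>Maximality of \<open>r\<close> is applied to the exponent \<open>a + 4\<close>,
    where \<open>32 A - A = 31 A <= d\<close>.\<close>
  have "int A * 31 \<le> int A * int m" using assms(2) by (intro mult_left_mono) auto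
  then have "5 + (a - 1) \<le> r"
    by (intro assms(5)) (simp only: pow d A(1)[symmetric], simp)
  then have r: "5 \<le> r - a + 1" "r = (r - a + 1) + (a - 1)" using assms(1) by linarith+
  \<comment> \<open>For \<open>m = 31\<close>, \<open>2 ^ r <= 32 A\<close> forces
    \<open>r - a + 1 = 5\<close>, and \<open>31 = 2^5 - 1\<close> is the excluded value.\<close>
  have "32 \<le> m"
  proof (rule ccontr)
    assume "\<not> 32 \<le> m"
    then have m: "m = 31" using assms(2) by simp
    have "(2::int) ^ (r - a + 1) * int A \<le> 32 * int A"
      using assms(4) r(2) pow[of "r - a + 1"] by (simp add: d m A)
    then have "(2::int) ^ (r - a + 1) \<le> 2 ^ 5" using A(2) by simp
    then have "r - a + 1 = 5" using r(1) by (simp only: power_increasing_iff) 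
    then show False using assms(6) m by simp
  qed
  have "(2::nat) ^ 5 \<le> 2 ^ (r - a + 1)" using r(1) by (intro power_increasing) auto
  then have n: "2 * m + 33 \<le> n" using assms(7) by simp
  have "Q_mm (A * m) a (A * n) \<le> q (A * m) a (A * n)"
  proof (cases "2 * n < 49 * (2 * m - 1)")
    case True
    then show ?thesis using a \<open>32 \<le> m\<close> n by (intro Q_mm_le_q_small)
  next
    case False
    define K where "K = 2 * n div (2 * m - 1)"
    \<comment> \<open>\<open>K\<close> lies between the consecutive squares \<open>(l - 1)^2\<close>
      and \<open>l^2\<close>, and \<open>K >= 49\<close> gives \<open>l >= 8\<close>.\<close>
    define l where "l = Suc (floor_sqrt K)"
    have pos: "0 < 2 * m - 1" using \<open>32 \<le> m\<close> by simp
    have "49 \<le> K" using False pos by (simp add: K_def less_eq_div_iff_mult_less_eq)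
    have l: "(l - 1)\<^sup>2 \<le> K" "K < l\<^sup>2"
      using floor_sqrt_power2_le[of K] Suc_floor_sqrt_power2_gt[of K] by (simp_all add: l_def)
    have "7\<^sup>2 < l\<^sup>2" using l(2) \<open>49 \<le> K\<close> by simp
    then have "8 \<le> l" using power_less_imp_less_base[of 7 2 l] by simp
    moreover have "(l - 1)\<^sup>2 * (2 * m - 1) \<le> 2 * n"
      using l(1) pos by (simp only: K_def less_eq_div_iff_mult_less_eq)
    moreover have "2 * n < l\<^sup>2 * (2 * m - 1)"
      using l(2) pos by (simp only: K_def div_less_iff_less_mult)
    ultimately show ?thesis using a \<open>32 \<le> m\<close> by (intro Q_mm_le_q_large)
  qed
  then show ?thesis by (simp add: Delta_mm_def assms(3) A_def)
qed

end
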